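(* Let $\xi_1=(Y_1,X_1),\ldots,\xi_n=(Y_n,X_n)$ be $n$ i.i.d. observations with distribution $P$ taking values in $\{0,1\}\times\mathbb{R}^p$. Let $g:\mathbb{R}^p\to\{0,1\}$ be a given classifier and let $\alpha_{max}\in(0,1)$. Consider the penalization function $$pen(\alpha)=\frac{1}{1-\alpha}\sqrt{\frac{\ln(n)}{2n}}$$ and define $$\hat{\alpha}=\operatorname*{arg\,min}_{\alpha\in[0,\alpha_{max}]}\left(R_{n,\alpha}(g)+pen(\alpha)\right).$$ Then $$E(R_{\hat{\alpha}}(g))\leq \inf_{\alpha\in[0,\alpha_{max}]}\left(R_\alpha(g)+pen(\alpha)+\frac{\sqrt{R(g)}}{\sqrt{n}(1-\alpha)}\right)+\frac{1}{1-\alpha_{max}}\sqrt{\frac{2\pi}{n}}+\frac{1}{n(1-\alpha_{max})^2}.$$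
   Context: A classifier is a (measurable) function $g:\mathbb{R}^p\to\{0,1\}$. Its classification error is $R(g)=P(\{(y,x)\in\{0,1\}\times\mathbb{R}^p: y\neq g(x)\})$. For a trimming level $\alpha\in[0,1)$, the set of $\alpha$-trimmed versions of a probability $P$ on $\{0,1\}\times\mathbb{R}^p$ is $\mathcal{R}_\alpha(P)=\{Q \text{ probability on } \{0,1\}\times\mathbb{R}^p: Q\ll P,\ \frac{dQ}{dP}\leq\frac{1}{1-\alpha}\ P\text{-a.s.}\}$ (so $\mathcal{R}_0(P)=\{P\}$). The trimmed classification error of $g$ is $R_\alpha(g)=\inf_{Q\in\mathcal{R}_\alpha(P)}Q(\{(y,x): g(x)\neq y\})$. The empirical trimmed classification error based on the sample $(Y_1,X_1),\dots,(Y_n,X_n)$ is $$R_{n,\alpha}(g)=\min_{w\in W}\sum_{i=1}^n w_i I_{(g(X_i)\neq Y_i)},\qquad W=\Big\{(w_1,\ldots,w_n): 0\leq w_i\leq\tfrac{1}{n(1-\alpha)},\ \sum_{i=1}^n w_i=1\Big\};$$ equivalently it is $\inf_{Q\in\mathcal{R}_\alpha(P_n)}Q(g(x)\neq y)$ where $P_n$ is the empirical distribution of the sample. $\hat\alpha$ is a (random, data-dependent) minimizer, $R_{\hat\alpha}(g)$ denotes $R_\alpha(g)$ evaluated at $\alpha=\hat\alpha$, and $E$ is expectation with respect to the sample. *)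

theory Defs
  imports "HOL-Probability.Probability"
begin

text \<open>Labels in \<open>{0,1}\<close> are rendered as \<^typ>\<open>bool\<close>, and an observation is a pair
  \<open>(y, x)\<close> of a label and a feature vector.\<close>

definition obs_space :: "(bool \<times> (real ^ 'p)) measure" where
  "obs_space = count_space UNIV \<Otimes>\<^sub>M borel"

definition classifier :: "(real ^ 'p \<Rightarrow> bool) \<Rightarrow> bool" where
  "classifier g \<longleftrightarrow> g \<in> borel \<rightarrow>\<^sub>M count_space UNIV"

definition class_error :: "(bool \<times> (real ^ 'p)) measure \<Rightarrow> (real ^ 'p \<Rightarrow> bool) \<Rightarrow> real" where
  "class_error P g = measure P {(y, x). y \<noteq> g x}"

definition trimmings :: "real \<Rightarrow> 'a measure \<Rightarrow> 'a measure set" where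
  "trimmings \<alpha> P = {Q. prob_space Q \<and> sets Q = sets P \<and> absolutely_continuous P Q \<and>
     (AE z in P. RN_deriv P Q z \<le> ennreal (1 / (1 - \<alpha>)))}"

definition trimmed_error ::
    "(bool \<times> (real ^ 'p)) measure \<Rightarrow> real \<Rightarrow> (real ^ 'p \<Rightarrow> bool) \<Rightarrow> real" where
  "trimmed_error P \<alpha> g = (INF Q\<in>trimmings \<alpha> P. measure Q {(y, x). g x \<noteq> y})"

text \<open>Only the coordinates \<open>1, \<dots>, n\<close> of a weight vector or of a sample matter below.\<close>

definition trimming_weights :: "nat \<Rightarrow> real \<Rightarrow> (nat \<Rightarrow> real) set" where
  "trimming_weights n \<alpha> =
     {w. (\<forall>i\<in>{1..n}. 0 \<le> w i \<and> w i \<le> 1 / (real n * (1 - \<alpha>))) \<and> (\<Sum>i=1..n. w i) = 1}"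

text \<open>The infimum is a minimum for \<open>n \<ge> 1\<close> and \<open>0 \<le> \<alpha> < 1\<close>: a linear function is minimized
  over a nonempty compact polytope.\<close>

definition emp_trimmed_error ::
    "nat \<Rightarrow> (nat \<Rightarrow> bool \<times> (real ^ 'p)) \<Rightarrow> real \<Rightarrow> (real ^ 'p \<Rightarrow> bool) \<Rightarrow> real" where
  "emp_trimmed_error n s \<alpha> g =
     (INF w\<in>trimming_weights n \<alpha>. \<Sum>i=1..n. w i * of_bool (g (snd (s i)) \<noteq> fst (s i)))"

definition pen :: "nat \<Rightarrow> real \<Rightarrow> real" where
  "pen n \<alpha> = 1 / (1 - \<alpha>) * sqrt (ln (real n) / (2 * real n))"

end

theory Submission
  imports Defs
begin

text \<open>
  Trimming may discard a fraction \<open>\<alpha>\<close> of the mass, and the error is smallest when as much of it as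
  possible is taken from the misclassified points. Hence the trimmed error depends on \<open>P\<close> only through
  \<open>r = R(g)\<close>, namely \<open>R\<^sub>\<alpha>(g) = max 0 ((r - \<alpha>) / (1 - \<alpha>))\<close>, and the empirical trimmed error is the
  same function of the empirical error \<open>r\<^sub>n\<close> (lemmas \<open>Inf_trimmings\<close> and \<open>emp_trimmed_error_eq\<close>).

  This function is Lipschitz in \<open>r\<close> with constant \<open>1 / (1 - \<alpha>)\<close>. The minimality of \<open>\<alpha>hat\<close> is therefore
  transferred from \<open>r\<^sub>n\<close> to \<open>r\<close> at a cost of \<open>\<bar>r\<^sub>n - r\<bar> / (1 - \<alpha>)\<close> at the competitor \<open>\<alpha>\<close> and of at most
  \<open>\<bar>r\<^sub>n - r\<bar> / (1 - \<alpha>max)\<close> at \<open>\<alpha>hat\<close>, and this second bound holds for all values of \<open>\<alpha>hat\<close>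
  simultaneously: the same scalar deviation controls every trimming level.

  It remains to bound \<open>E\<bar>r\<^sub>n - r\<bar>\<close>, for which the variance of a mean of \<open>n\<close> independent Bernoulli
  variables suffices: \<open>E\<bar>r\<^sub>n - r\<bar> \<le> sqrt (r (1 - r) / n)\<close>. At the competitor it is bounded by
  \<open>sqrt r / sqrt n\<close>, and at \<open>\<alpha>hat\<close> by \<open>sqrt (2 \<pi> / n)\<close>, since \<open>r \<le> 1 \<le> 2 \<pi>\<close>.
\<close>

section \<open>Trimming as a function of the error rate\<close>

definition trimmed_rate :: "real \<Rightarrow> real \<Rightarrow> real" where
  "trimmed_rate \<alpha> r = max 0 ((r - \<alpha>) / (1 - \<alpha>))"

text \<open>The density of an optimal trimming as a function of whether a point lies in the set whose mass
  \<open>r\<close> is to be minimized: mass \<open>trimmed_rate \<alpha> r\<close> is spread evenly over that set and the rest evenly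
  over its complement. For \<open>0 \<le> \<alpha> < 1\<close> the divisions by zero at \<open>r = 0\<close> and \<open>r = 1\<close> do no harm,
  because the numerator vanishes as well.\<close>

definition trimmed_weight :: "real \<Rightarrow> real \<Rightarrow> bool \<Rightarrow> real" where
  "trimmed_weight \<alpha> r b = (if b then trimmed_rate \<alpha> r / r else (1 - trimmed_rate \<alpha> r) / (1 - r))"

lemma trimmed_rate_nonneg: "0 \<le> trimmed_rate \<alpha> r"
  by (simp add: trimmed_rate_def)

lemma trimmed_rate_bounds:
  assumes "0 \<le> \<alpha>" "\<alpha> < 1" "0 \<le> r" "r \<le> 1"
  shows "trimmed_rate \<alpha> r \<le> r" "r - \<alpha> \<le> (1 - \<alpha>) * trimmed_rate \<alpha> r"
proof -
  have "\<alpha> * r \<le> \<alpha> * 1"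
    using assms by (intro mult_left_mono) auto
  then show "trimmed_rate \<alpha> r \<le> r"
    using assms by (simp add: trimmed_rate_def field_simps)
  have "r - \<alpha> = (1 - \<alpha>) * ((r - \<alpha>) / (1 - \<alpha>))"
    using assms by simp
  also have "\<dots> \<le> (1 - \<alpha>) * trimmed_rate \<alpha> r"
    using assms by (intro mult_left_mono) (auto simp: trimmed_rate_def)
  finally show "r - \<alpha> \<le> (1 - \<alpha>) * trimmed_rate \<alpha> r" .
qed

text \<open>The constraint on a trimming bounds the mass of the complement by \<open>(1 - r) / (1 - \<alpha>)\<close>, which is
  what bounds the mass \<open>q\<close> of the set itself from below.\<close>

lemma trimmed_rate_le:
  assumes "\<alpha> < 1" "0 \<le> q" "1 - q \<le> (1 - r) / (1 - \<alpha>)"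
  shows "trimmed_rate \<alpha> r \<le> q"
  using assms by (simp add: trimmed_rate_def field_simps)

lemma trimmed_weight_mass:
  assumes "0 \<le> \<alpha>" "\<alpha> < 1" "0 \<le> r" "r \<le> 1"
  shows "trimmed_weight \<alpha> r True * r = trimmed_rate \<alpha> r"
    and "trimmed_weight \<alpha> r False * (1 - r) = 1 - trimmed_rate \<alpha> r"
proof -
  show "trimmed_weight \<alpha> r True * r = trimmed_rate \<alpha> r"
    using trimmed_rate_bounds(1)[OF assms] trimmed_rate_nonneg[of \<alpha> r]
    by (cases "r = 0") (auto simp: trimmed_weight_def)
  show "trimmed_weight \<alpha> r False * (1 - r) = 1 - trimmed_rate \<alpha> r"
    using assms by (cases "r = 1") (auto simp: trimmed_weight_def trimmed_rate_def)
qed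

lemma trimmed_weight_bounds:
  assumes "0 \<le> \<alpha>" "\<alpha> < 1" "0 \<le> r" "r \<le> 1"
  shows "0 \<le> trimmed_weight \<alpha> r b" "trimmed_weight \<alpha> r b \<le> 1 / (1 - \<alpha>)"
proof -
  note t = trimmed_rate_bounds[OF assms] trimmed_rate_nonneg[of \<alpha> r]
  show "0 \<le> trimmed_weight \<alpha> r b"
    using t assms by (auto simp: trimmed_weight_def)
  have "trimmed_rate \<alpha> r / r \<le> 1 / (1 - \<alpha>)"
  proof (cases "r = 0")
    case False
    have "trimmed_rate \<alpha> r / r \<le> 1"
      using t assms False by (simp add: divide_le_eq)
    also have "1 \<le> 1 / (1 - \<alpha>)"
      using assms by simp
    finally show ?thesis .
  qed (use assms in simp)
  moreover have "(1 - trimmed_rate \<alpha> r) / (1 - r) \<le> 1 / (1 - \<alpha>)"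
    using t assms by (cases "r = 1") (auto simp: field_simps)
  ultimately show "trimmed_weight \<alpha> r b \<le> 1 / (1 - \<alpha>)"
    by (simp add: trimmed_weight_def)
qed

lemma trimmed_rate_lipschitz:
  assumes "\<alpha> < 1"
  shows "trimmed_rate \<alpha> r \<le> trimmed_rate \<alpha> r' + \<bar>r - r'\<bar> / (1 - \<alpha>)"
proof -
  have "(r - \<alpha>) / (1 - \<alpha>) = (r' - \<alpha>) / (1 - \<alpha>) + (r - r') / (1 - \<alpha>)"
    by (simp add: diff_divide_distrib)
  moreover have "(r - r') / (1 - \<alpha>) \<le> \<bar>r - r'\<bar> / (1 - \<alpha>)" "0 \<le> \<bar>r - r'\<bar> / (1 - \<alpha>)"
    using assms by (auto intro: divide_right_mono)
  ultimately show ?thesis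
    by (simp add: trimmed_rate_def)
qed

section \<open>Trimmed errors of probability measures and of samples\<close>

text \<open>The density bound applies to the complement of \<open>A\<close>, which can thus gain at most a factor
  \<open>1 / (1 - \<alpha>)\<close>; all remaining mass of \<open>Q\<close> is forced onto \<open>A\<close>.\<close>

lemma (in prob_space) trimmings_prob_ge:
  assumes Q: "Q \<in> trimmings \<alpha> M" and "\<alpha> < 1" and A: "A \<in> events"
  shows "trimmed_rate \<alpha> (prob A) \<le> measure Q A"
proof -
  interpret Q: prob_space Q
    using Q by (simp add: trimmings_def)
  have sets_Q: "sets Q = events" and ac: "absolutely_continuous M Q"
    and dens: "AE z in M. RN_deriv M Q z \<le> ennreal (1 / (1 - \<alpha>))"
    using Q by (auto simp: trimmings_def)
  have space_Q: "space Q = space M"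
    by (rule sets_eq_imp_space_eq[OF sets_Q])
  define B where "B = space M - A"
  have B: "B \<in> events"
    using A by (auto simp: B_def)
  have "emeasure Q B = emeasure (density M (RN_deriv M Q)) B"
    using density_RN_deriv[OF ac sets_Q] by simp
  also have "\<dots> = (\<integral>\<^sup>+z. RN_deriv M Q z * indicator B z \<partial>M)"
    using B by (simp add: emeasure_density)
  also have "\<dots> \<le> (\<integral>\<^sup>+z. ennreal (1 / (1 - \<alpha>)) * indicator B z \<partial>M)"
    using dens by (intro nn_integral_mono_AE) (auto elim!: eventually_mono split: split_indicator)
  also have "\<dots> = ennreal (1 / (1 - \<alpha>) * prob B)"
    using B \<open>\<alpha> < 1\<close>
    by (simp add: nn_integral_cmult_indicator emeasure_eq_measure ennreal_mult[symmetric])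
  finally have "measure Q B \<le> 1 / (1 - \<alpha>) * prob B"
    using \<open>\<alpha> < 1\<close> by (simp add: Q.emeasure_eq_measure)
  then show ?thesis
    using A Q.prob_compl[of A] prob_compl[of A] \<open>\<alpha> < 1\<close>
    by (intro trimmed_rate_le) (auto simp: B_def sets_Q space_Q)
qed

text \<open>The witness has density \<open>trimmed_weight\<close>, constant on \<open>A\<close> and on its complement.\<close>

lemma (in prob_space) trimmings_prob_attained:
  assumes "0 \<le> \<alpha>" "\<alpha> < 1" and A: "A \<in> events"
  shows "\<exists>Q\<in>trimmings \<alpha> M. measure Q A = trimmed_rate \<alpha> (prob A)"
proof -
  define r where "r = prob A"
  have r: "0 \<le> r" "r \<le> 1"
    by (auto simp: r_def)
  note w = trimmed_weight_bounds[OF assms(1,2) r]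
  note mass = trimmed_weight_mass[OF assms(1,2) r]
  define h where "h z = ennreal (trimmed_weight \<alpha> r (z \<in> A))" for z
  have h_split: "h z = ennreal (trimmed_weight \<alpha> r True) * indicator A z
      + ennreal (trimmed_weight \<alpha> r False) * indicator (space M - A) z" if "z \<in> space M" for z
    using that by (auto simp: h_def split: split_indicator)
  have h_meas [measurable]: "h \<in> borel_measurable M"
    using A by (subst measurable_cong[OF h_split]) auto
  define Q where "Q = density M h"
  have Q_A: "emeasure Q A = ennreal (trimmed_rate \<alpha> r)"
  proof -
    have "emeasure Q A = (\<integral>\<^sup>+z. h z * indicator A z \<partial>M)"
      using A by (simp add: Q_def emeasure_density)
    also have "\<dots> = (\<integral>\<^sup>+z. ennreal (trimmed_weight \<alpha> r True) * indicator A z \<partial>M)"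
      by (intro nn_integral_cong) (auto simp: h_def split: split_indicator)
    also have "\<dots> = ennreal (trimmed_weight \<alpha> r True * r)"
      using A w[of True] r
      by (simp add: nn_integral_cmult_indicator emeasure_eq_measure ennreal_mult r_def)
    finally show ?thesis
      using mass by simp
  qed
  have Q_compl: "emeasure Q (space M - A) = ennreal (1 - trimmed_rate \<alpha> r)"
  proof -
    have "emeasure Q (space M - A) = (\<integral>\<^sup>+z. h z * indicator (space M - A) z \<partial>M)"
      using A by (simp add: Q_def emeasure_density)
    also have "\<dots> = (\<integral>\<^sup>+z. ennreal (trimmed_weight \<alpha> r False) * indicator (space M - A) z \<partial>M)"
      by (intro nn_integral_cong) (auto simp: h_def split: split_indicator)
    also have "\<dots> = ennreal (trimmed_weight \<alpha> r False) * emeasure M (space M - A)"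
      using A by (intro nn_integral_cmult_indicator) auto
    also have "emeasure M (space M - A) = ennreal (1 - r)"
      using A prob_compl[of A] by (simp add: emeasure_eq_measure r_def)
    also have "ennreal (trimmed_weight \<alpha> r False) * ennreal (1 - r)
        = ennreal (trimmed_weight \<alpha> r False * (1 - r))"
      using w[of False] r by (simp add: ennreal_mult)
    finally show ?thesis
      using mass by simp
  qed
  have "emeasure Q (space Q) = emeasure Q A + emeasure Q (space M - A)"
  proof -
    have "A \<union> (space M - A) = space Q"
      using A[THEN sets.sets_into_space] by (auto simp: Q_def)
    moreover have "A \<in> sets Q" "space M - A \<in> sets Q"
      using A by (auto simp: Q_def)
    ultimately show ?thesis
      using plus_emeasure[of A Q "space M - A"] by auto
  qed
  also have "\<dots> = ennreal (trimmed_rate \<alpha> r + (1 - trimmed_rate \<alpha> r))"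
    unfolding Q_A Q_compl
    using trimmed_rate_nonneg[of \<alpha> r] trimmed_rate_bounds(1)[OF assms(1,2) r] r
    by (intro ennreal_plus[symmetric]) auto
  finally have "prob_space Q"
    by (intro prob_spaceI) simp
  moreover have "AE z in M. RN_deriv M Q z \<le> ennreal (1 / (1 - \<alpha>))"
    using RN_deriv_unique[OF h_meas Q_def[symmetric]]
    by eventually_elim (metis h_def w(2) ennreal_leI)
  ultimately have "Q \<in> trimmings \<alpha> M"
    by (auto simp: trimmings_def Q_def intro: absolutely_continuousI_density)
  moreover have "measure Q A = trimmed_rate \<alpha> r"
    using Q_A trimmed_rate_nonneg[of \<alpha> r] by (simp add: measure_def)
  ultimately show ?thesis
    by (auto simp: r_def)
qed

lemma (in prob_space) Inf_trimmings:
  assumes "0 \<le> \<alpha>" "\<alpha> < 1" "A \<in> events"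
  shows "(INF Q\<in>trimmings \<alpha> M. measure Q A) = trimmed_rate \<alpha> (prob A)"
  using trimmings_prob_attained[OF assms] trimmings_prob_ge[OF _ assms(2,3)]
  by (intro cInf_eq_minimum) (auto intro!: rev_image_eqI)

definition emp_error :: "nat \<Rightarrow> (nat \<Rightarrow> bool \<times> (real ^ 'p)) \<Rightarrow> (real ^ 'p \<Rightarrow> bool) \<Rightarrow> real" where
  "emp_error n s g = (\<Sum>i=1..n. of_bool (g (snd (s i)) \<noteq> fst (s i))) / real n"

lemma emp_error_bounds: "0 \<le> emp_error n s g" "emp_error n s g \<le> 1"
proof -
  show "0 \<le> emp_error n s g"
    by (auto simp: emp_error_def intro!: divide_nonneg_nonneg sum_nonneg)
  have "(\<Sum>i=1..n. of_bool (g (snd (s i)) \<noteq> fst (s i))) \<le> (\<Sum>i=1..n. 1::real)"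
    by (intro sum_mono) auto
  then show "emp_error n s g \<le> 1"
    by (cases "n = 0") (auto simp: emp_error_def)
qed

text \<open>The discrete counterpart of \<open>Inf_trimmings\<close>: the optimal weights are the values of
  \<open>trimmed_weight\<close> divided by \<open>n\<close>, and the cap on the weights of the correctly classified points
  gives the lower bound.\<close>

lemma emp_trimmed_error_eq:
  assumes n: "n \<ge> 1" and \<alpha>: "0 \<le> \<alpha>" "\<alpha> < 1"
  shows "emp_trimmed_error n s \<alpha> g = trimmed_rate \<alpha> (emp_error n s g)"
proof -
  define e where "e i = (g (snd (s i)) \<noteq> fst (s i))" for i
  define r where "r = emp_error n s g"
  have r: "0 \<le> r" "r \<le> 1"
    by (auto simp: r_def emp_error_bounds)
  have sum_e: "(\<Sum>i=1..n. of_bool (e i)) = real n * r"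
    using n by (simp add: r_def emp_error_def e_def)
  have sum_not_e: "(\<Sum>i=1..n. 1 - of_bool (e i)) = real n * (1 - r)"
    using sum_e by (simp add: sum_subtractf algebra_simps)
  define w where "w i = trimmed_weight \<alpha> r (e i) / real n" for i
  have w_e: "(\<Sum>i=1..n. w i * of_bool (e i)) = trimmed_rate \<alpha> r"
  proof -
    have "(\<Sum>i=1..n. w i * of_bool (e i))
        = (\<Sum>i=1..n. trimmed_weight \<alpha> r True / real n * of_bool (e i))"
      by (intro sum.cong) (auto simp: w_def)
    also have "\<dots> = trimmed_weight \<alpha> r True / real n * (real n * r)"
      by (simp only: sum_distrib_left[symmetric] sum_e)
    also have "\<dots> = trimmed_rate \<alpha> r"
      using n trimmed_weight_mass(1)[OF \<alpha> r] by simp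
    finally show ?thesis .
  qed
  have w_not_e: "(\<Sum>i=1..n. w i * (1 - of_bool (e i))) = 1 - trimmed_rate \<alpha> r"
  proof -
    have "w i * (1 - of_bool (e i)) = trimmed_weight \<alpha> r False / real n * (1 - of_bool (e i))" for i
      by (cases "e i") (simp_all add: w_def)
    then have "(\<Sum>i=1..n. w i * (1 - of_bool (e i)))
        = (\<Sum>i=1..n. trimmed_weight \<alpha> r False / real n * (1 - of_bool (e i)))"
      by simp
    also have "\<dots> = trimmed_weight \<alpha> r False / real n * (real n * (1 - r))"
      by (simp only: sum_distrib_left[symmetric] sum_not_e)
    also have "\<dots> = 1 - trimmed_rate \<alpha> r"
      using n trimmed_weight_mass(2)[OF \<alpha> r] by simp
    finally show ?thesis .
  qed
  have "(\<Sum>i=1..n. w i) = (\<Sum>i=1..n. w i * of_bool (e i)) + (\<Sum>i=1..n. w i * (1 - of_bool (e i)))"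
    by (simp only: sum.distrib[symmetric]) (simp add: distrib_left[symmetric])
  then have "(\<Sum>i=1..n. w i) = 1"
    by (simp only: w_e w_not_e)
  moreover have "w i \<le> 1 / (real n * (1 - \<alpha>))" for i
    using divide_right_mono[OF trimmed_weight_bounds(2)[OF \<alpha> r, of "e i"], of "real n"]
    by (simp add: w_def mult.commute)
  ultimately have w: "w \<in> trimming_weights n \<alpha>"
    using trimmed_weight_bounds(1)[OF \<alpha> r] by (auto simp: trimming_weights_def w_def)
  have lower: "trimmed_rate \<alpha> r \<le> (\<Sum>i=1..n. v i * of_bool (e i))"
    if v: "v \<in> trimming_weights n \<alpha>" for v
  proof (rule trimmed_rate_le)
    have "1 - (\<Sum>i=1..n. v i * of_bool (e i)) = (\<Sum>i=1..n. v i * (1 - of_bool (e i)))"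
      using v by (simp add: trimming_weights_def right_diff_distrib sum_subtractf)
    also have "\<dots> \<le> (\<Sum>i=1..n. 1 / (real n * (1 - \<alpha>)) * (1 - of_bool (e i)))"
      using v by (intro sum_mono mult_right_mono) (auto simp: trimming_weights_def)
    also have "\<dots> = 1 / (real n * (1 - \<alpha>)) * (real n * (1 - r))"
      by (simp only: sum_distrib_left[symmetric] sum_not_e)
    also have "\<dots> = (1 - r) / (1 - \<alpha>)"
      using n by simp
    finally show "1 - (\<Sum>i=1..n. v i * of_bool (e i)) \<le> (1 - r) / (1 - \<alpha>)" .
  qed (use v \<alpha> in \<open>auto simp: trimming_weights_def intro!: sum_nonneg\<close>)
  show ?thesis
    unfolding emp_trimmed_error_def e_def[symmetric] r_def[symmetric]
    using w w_e lower by (intro cInf_eq_minimum) (auto intro!: rev_image_eqI)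
qed

section \<open>Mean deviation of an empirical frequency\<close>

text \<open>Bienayme's identity: independence and centring make the mixed terms of the expanded square
  vanish.\<close>

lemma (in prob_space) second_moment_sum_indep:
  fixes Y :: "'i \<Rightarrow> 'a \<Rightarrow> real"
  assumes "finite I" and indep: "indep_vars (\<lambda>_. borel) Y I"
    and int: "\<And>i. i \<in> I \<Longrightarrow> integrable M (Y i)"
    and int2: "\<And>i. i \<in> I \<Longrightarrow> integrable M (\<lambda>\<omega>. (Y i \<omega>)\<^sup>2)"
    and centred: "\<And>i. i \<in> I \<Longrightarrow> expectation (Y i) = 0"
  shows "integrable M (\<lambda>\<omega>. (\<Sum>i\<in>I. Y i \<omega>)\<^sup>2)"
    and "expectation (\<lambda>\<omega>. (\<Sum>i\<in>I. Y i \<omega>)\<^sup>2) = (\<Sum>i\<in>I. expectation (\<lambda>\<omega>. (Y i \<omega>)\<^sup>2))"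
proof -
  have pair: "integrable M (\<lambda>\<omega>. Y i \<omega> * Y j \<omega>)"
      "expectation (\<lambda>\<omega>. Y i \<omega> * Y j \<omega>) = (if i = j then expectation (\<lambda>\<omega>. (Y i \<omega>)\<^sup>2) else 0)"
    if ij: "i \<in> I" "j \<in> I" for i j
  proof -
    have off: "integrable M (\<lambda>\<omega>. Y i \<omega> * Y j \<omega>) \<and> expectation (\<lambda>\<omega>. Y i \<omega> * Y j \<omega>) = 0"
      if "i \<noteq> j"
    proof -
      have "indep_vars (\<lambda>_. borel) Y {i, j}"
        using ij by (intro indep_vars_subset[OF indep]) auto
      then show ?thesis
        using indep_vars_integrable[of "{i, j}" Y] indep_vars_lebesgue_integral[of "{i, j}" Y]
          int centred ij \<open>i \<noteq> j\<close> by auto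
    qed
    show "integrable M (\<lambda>\<omega>. Y i \<omega> * Y j \<omega>)"
      using off int2[OF ij(1)] by (cases "i = j") (auto simp: power2_eq_square)
    show "expectation (\<lambda>\<omega>. Y i \<omega> * Y j \<omega>) = (if i = j then expectation (\<lambda>\<omega>. (Y i \<omega>)\<^sup>2) else 0)"
      using off by (auto simp: power2_eq_square)
  qed
  have square: "(\<Sum>i\<in>I. Y i \<omega>)\<^sup>2 = (\<Sum>i\<in>I. \<Sum>j\<in>I. Y i \<omega> * Y j \<omega>)" for \<omega>
    by (simp add: power2_eq_square sum_product)
  show "integrable M (\<lambda>\<omega>. (\<Sum>i\<in>I. Y i \<omega>)\<^sup>2)"
    unfolding square using pair by (intro Bochner_Integration.integrable_sum) auto
  have "expectation (\<lambda>\<omega>. (\<Sum>i\<in>I. Y i \<omega>)\<^sup>2)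
      = (\<Sum>i\<in>I. \<Sum>j\<in>I. expectation (\<lambda>\<omega>. Y i \<omega> * Y j \<omega>))"
    unfolding square using pair
    by (simp add: Bochner_Integration.integral_sum Bochner_Integration.integrable_sum)
  also have "\<dots> = (\<Sum>i\<in>I. expectation (\<lambda>\<omega>. (Y i \<omega>)\<^sup>2))"
    using pair \<open>finite I\<close> by (intro sum.cong refl) simp
  finally show "expectation (\<lambda>\<omega>. (\<Sum>i\<in>I. Y i \<omega>)\<^sup>2) = (\<Sum>i\<in>I. expectation (\<lambda>\<omega>. (Y i \<omega>)\<^sup>2))" .
qed

lemma (in prob_space) expectation_abs_le_sqrt:
  assumes [measurable]: "X \<in> borel_measurable M" and "integrable M (\<lambda>\<omega>. (X \<omega>)\<^sup>2 :: real)"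
  shows "integrable M X" "expectation (\<lambda>\<omega>. \<bar>X \<omega>\<bar>) \<le> sqrt (expectation (\<lambda>\<omega>. (X \<omega>)\<^sup>2))"
proof -
  show int: "integrable M X"
    using assms by (rule square_integrable_imp_integrable)
  have "0 \<le> variance (\<lambda>\<omega>. \<bar>X \<omega>\<bar>)"
    by (rule variance_positive)
  also have "\<dots> = expectation (\<lambda>\<omega>. (X \<omega>)\<^sup>2) - (expectation (\<lambda>\<omega>. \<bar>X \<omega>\<bar>))\<^sup>2"
    using assms int by (subst variance_eq) auto
  finally show "expectation (\<lambda>\<omega>. \<bar>X \<omega>\<bar>) \<le> sqrt (expectation (\<lambda>\<omega>. (X \<omega>)\<^sup>2))"
    by (intro real_le_rsqrt) simp
qed

text \<open>The second moment of the deviation of a frequency is \<open>r (1 - r) / n\<close>, and it dominates the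
  square of the mean absolute deviation.\<close>

lemma (in prob_space) mean_deviation_bernoulli:
  fixes A :: "'i \<Rightarrow> 'a \<Rightarrow> bool"
  assumes I: "finite I" "I \<noteq> {}"
    and indep: "indep_vars (\<lambda>_. count_space UNIV) A I"
    and prob_A: "\<And>i. i \<in> I \<Longrightarrow> prob {\<omega> \<in> space M. A i \<omega>} = r"
  defines "D \<equiv> \<lambda>\<omega>. (\<Sum>i\<in>I. of_bool (A i \<omega>)) / real (card I) - r"
  shows "integrable M D"
    and "expectation (\<lambda>\<omega>. \<bar>D \<omega>\<bar>) \<le> sqrt (r * (1 - r) / real (card I))"
proof -
  define Y where "Y i \<omega> = (of_bool (A i \<omega>) - r :: real)" for i \<omega>
  define N where "N = real (card I)"
  have N: "N > 0"
    using I by (simp add: N_def card_gt_0_iff)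
  have [measurable]: "A i \<in> measurable M (count_space UNIV)" if "i \<in> I" for i
    using indep that by (auto simp: indep_vars_def)
  have int_A: "integrable M (\<lambda>\<omega>. of_bool (A i \<omega>) :: real)" if "i \<in> I" for i
    using that by (intro integrable_const_bound[where B=1]) auto
  have exp_A: "expectation (\<lambda>\<omega>. of_bool (A i \<omega>)) = r" if "i \<in> I" for i
  proof -
    have "expectation (\<lambda>\<omega>. of_bool (A i \<omega>))
        = expectation (indicator {\<omega> \<in> space M. A i \<omega>} :: 'a \<Rightarrow> real)"
      by (intro Bochner_Integration.integral_cong) (auto split: split_indicator)
    then show ?thesis
      using that prob_A by simp
  qed
  \<comment> \<open>Indicators are idempotent, so the square is affine in the indicator.\<close>
  have Y_sq: "(Y i \<omega>)\<^sup>2 = (1 - 2 * r) * of_bool (A i \<omega>) + r\<^sup>2" for i \<omega>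
    by (auto simp: Y_def power2_eq_square algebra_simps)
  have indep_Y: "indep_vars (\<lambda>_. borel) Y I"
    using indep_vars_compose2[OF indep, of "\<lambda>_ b. of_bool b - r" "\<lambda>_. borel"]
    by (simp add: Y_def[abs_def])
  have int_Y: "integrable M (Y i)" and exp_Y: "expectation (Y i) = 0" if "i \<in> I" for i
    using int_A[OF that] exp_A[OF that] by (simp_all add: Y_def[abs_def] prob_space)
  have int_Y2: "integrable M (\<lambda>\<omega>. (Y i \<omega>)\<^sup>2)" if "i \<in> I" for i
    unfolding Y_sq using int_A[OF that] by simp
  have exp_Y2: "expectation (\<lambda>\<omega>. (Y i \<omega>)\<^sup>2) = r * (1 - r)" if "i \<in> I" for i
  proof -
    have "expectation (\<lambda>\<omega>. (Y i \<omega>)\<^sup>2) = (1 - 2 * r) * expectation (\<lambda>\<omega>. of_bool (A i \<omega>)) + r\<^sup>2"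
      unfolding Y_sq using int_A[OF that] by (simp add: prob_space)
    then show ?thesis
      by (simp add: exp_A[OF that] power2_eq_square algebra_simps)
  qed
  note sum_Y = second_moment_sum_indep[OF I(1) indep_Y int_Y int_Y2 exp_Y]
  have D_eq: "D \<omega> = (\<Sum>i\<in>I. Y i \<omega>) / N" for \<omega>
    using N by (simp add: D_def Y_def sum_subtractf diff_divide_distrib flip: N_def)
  have D_meas: "D \<in> borel_measurable M"
    using int_Y unfolding D_eq[abs_def]
    by (intro borel_measurable_divide borel_measurable_sum borel_measurable_const
        borel_measurable_integrable)
  have int_D2: "integrable M (\<lambda>\<omega>. (D \<omega>)\<^sup>2)"
    using sum_Y(1) by (simp add: D_eq power_divide)
  have "expectation (\<lambda>\<omega>. (D \<omega>)\<^sup>2) = (\<Sum>i\<in>I. expectation (\<lambda>\<omega>. (Y i \<omega>)\<^sup>2)) / N\<^sup>2"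
    by (simp add: D_eq power_divide sum_Y(2))
  also have "(\<Sum>i\<in>I. expectation (\<lambda>\<omega>. (Y i \<omega>)\<^sup>2)) = N * (r * (1 - r))"
    by (simp add: exp_Y2 N_def)
  also have "N * (r * (1 - r)) / N\<^sup>2 = r * (1 - r) / N"
    using N by (simp add: power2_eq_square)
  finally show "expectation (\<lambda>\<omega>. \<bar>D \<omega>\<bar>) \<le> sqrt (r * (1 - r) / real (card I))"
    using expectation_abs_le_sqrt(2)[OF D_meas int_D2] by (simp add: N_def)
  show "integrable M D"
    by (rule expectation_abs_le_sqrt(1)[OF D_meas int_D2])
qed

section \<open>The risk bound for the selected trimming level\<close>

theorem theorem3p1:
  fixes M :: "'w measure"
    and P :: "(bool \<times> (real ^ 'p)) measure"
    and \<xi> :: "nat \<Rightarrow> 'w \<Rightarrow> bool \<times> (real ^ 'p)"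
    and g :: "real ^ 'p \<Rightarrow> bool"
    and n :: nat
    and \<alpha>max :: real
    and \<alpha>hat :: "(nat \<Rightarrow> bool \<times> (real ^ 'p)) \<Rightarrow> real"
  assumes "prob_space M"
    and "prob_space P" and "sets P = sets obs_space"
    and "n \<ge> 1"
    and "prob_space.indep_vars M (\<lambda>_. obs_space) \<xi> {1..n}"
    and "\<forall>i\<in>{1..n}. distr M obs_space (\<xi> i) = P"
    and "classifier g"
    and "0 < \<alpha>max" and "\<alpha>max < 1"
    and "\<alpha>hat \<in> borel_measurable (Pi\<^sub>M {1..n} (\<lambda>_. obs_space))"
    and "\<forall>s\<in>space (Pi\<^sub>M {1..n} (\<lambda>_. obs_space)).
           is_arg_min (\<lambda>\<alpha>. emp_trimmed_error n s \<alpha> g + pen n \<alpha>) (\<lambda>\<alpha>. \<alpha> \<in> {0..\<alpha>max}) (\<alpha>hat s)"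
  shows "prob_space.expectation M
           (\<lambda>\<omega>. trimmed_error P (\<alpha>hat (\<lambda>i\<in>{1..n}. \<xi> i \<omega>)) g)
         \<le> (INF \<alpha>\<in>{0..\<alpha>max}. trimmed_error P \<alpha> g + pen n \<alpha>
               + sqrt (class_error P g) / (sqrt (real n) * (1 - \<alpha>)))
           + 1 / (1 - \<alpha>max) * sqrt (2 * pi / real n)
           + 1 / (real n * (1 - \<alpha>max)^2)"
proof -
  interpret M: prob_space M by fact
  interpret P: prob_space P by fact
  note n = \<open>n \<ge> 1\<close> and \<alpha>max = \<open>0 < \<alpha>max\<close> \<open>\<alpha>max < 1\<close> and indep = assms(5)
  have g [measurable]: "g \<in> borel \<rightarrow>\<^sub>M count_space UNIV"
    using \<open>classifier g\<close> by (simp add: classifier_def)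
  define wrong where "wrong z = (g (snd z) \<noteq> fst z)" for z
  have wrong_meas [measurable]: "wrong \<in> obs_space \<rightarrow>\<^sub>M count_space UNIV"
    unfolding wrong_def obs_space_def by measurable
  have space_obs: "space (obs_space :: (bool \<times> (real ^ 'p)) measure) = UNIV"
    by (simp add: obs_space_def space_pair_measure)
  have wrong_set: "{z. wrong z} \<in> sets obs_space"
    using measurable_sets[OF wrong_meas, of "{True}"] by (simp add: space_obs vimage_def)
  define r where "r = class_error P g"
  have r_eq: "r = measure P {z. wrong z}"
    unfolding r_def class_error_def by (rule arg_cong[where f="measure P"]) (auto simp: wrong_def)
  have r: "0 \<le> r" "r \<le> 1"
    by (auto simp: r_eq)
  have trimmed_error_eq: "trimmed_error P \<alpha> g = trimmed_rate \<alpha> r" if "0 \<le> \<alpha>" "\<alpha> < 1" for \<alpha>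
  proof -
    have "{(y, x). g x \<noteq> y} = {z. wrong z}"
      by (auto simp: wrong_def)
    then show ?thesis
      using P.Inf_trimmings[OF that] wrong_set assms(3) by (simp add: trimmed_error_def r_eq)
  qed

  define S where "S \<omega> = (\<lambda>i\<in>{1..n}. \<xi> i \<omega>)" for \<omega>
  define D where "D \<omega> = emp_error n (S \<omega>) g - r" for \<omega>
  have D: "integrable M D" "M.expectation (\<lambda>\<omega>. \<bar>D \<omega>\<bar>) \<le> sqrt (r * (1 - r) / real n)"
  proof -
    have "emp_error n (S \<omega>) g = (\<Sum>i\<in>{1..n}. of_bool (wrong (\<xi> i \<omega>))) / real (card {1..n})" for \<omega>
      unfolding emp_error_def by (intro arg_cong2[where f="(/)"] sum.cong) (auto simp: S_def wrong_def)
    then have D_eq: "D = (\<lambda>\<omega>. (\<Sum>i\<in>{1..n}. of_bool (wrong (\<xi> i \<omega>))) / real (card {1..n}) - r)"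
      by (simp add: D_def fun_eq_iff)
    have indep_wrong: "M.indep_vars (\<lambda>_. count_space UNIV) (\<lambda>i \<omega>. wrong (\<xi> i \<omega>)) {1..n}"
      by (rule M.indep_vars_compose2[OF indep]) simp
    have prob_wrong: "M.prob {\<omega> \<in> space M. wrong (\<xi> i \<omega>)} = r" if i: "i \<in> {1..n}" for i
    proof -
      have "\<xi> i \<in> M \<rightarrow>\<^sub>M obs_space"
        using indep i by (auto simp: M.indep_vars_def)
      then have "measure (distr M obs_space (\<xi> i)) {z. wrong z} = M.prob {\<omega> \<in> space M. wrong (\<xi> i \<omega>)}"
        using wrong_set by (subst measure_distr) (auto intro!: arg_cong[where f=M.prob])
      then show ?thesis
        using assms(6) i by (simp add: r_eq)
    qed
    show "integrable M D"
      unfolding D_eq using n by (intro M.mean_deviation_bernoulli indep_wrong prob_wrong) auto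
    show "M.expectation (\<lambda>\<omega>. \<bar>D \<omega>\<bar>) \<le> sqrt (r * (1 - r) / real n)"
      unfolding D_eq using n
        M.mean_deviation_bernoulli(2)[OF _ _ indep_wrong prob_wrong] by simp
  qed

  have pen_nonneg: "0 \<le> pen n \<alpha>" if "\<alpha> < 1" for \<alpha>
    using n that by (simp add: pen_def)
  have risk_bound: "M.expectation (\<lambda>\<omega>. trimmed_error P (\<alpha>hat (S \<omega>)) g)
      \<le> trimmed_error P \<alpha> g + pen n \<alpha> + sqrt r / (sqrt (real n) * (1 - \<alpha>))
        + 1 / (1 - \<alpha>max) * sqrt (2 * pi / real n)"
    if \<alpha>: "\<alpha> \<in> {0..\<alpha>max}" for \<alpha>
  proof -
    have \<alpha>1: "0 \<le> \<alpha>" "\<alpha> < 1"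
      using \<alpha> \<alpha>max by auto
    define c where "c = 1 / (1 - \<alpha>) + 1 / (1 - \<alpha>max)"
    have pointwise: "trimmed_error P (\<alpha>hat (S \<omega>)) g \<le> trimmed_rate \<alpha> r + pen n \<alpha> + c * \<bar>D \<omega>\<bar>" for \<omega>
    proof -
      define h where "h = \<alpha>hat (S \<omega>)"
      have "S \<omega> \<in> space (Pi\<^sub>M {1..n} (\<lambda>_. obs_space))"
        by (simp add: space_PiM space_obs S_def)
      then have arg_min: "is_arg_min (\<lambda>\<alpha>. emp_trimmed_error n (S \<omega>) \<alpha> g + pen n \<alpha>)
          (\<lambda>\<alpha>. \<alpha> \<in> {0..\<alpha>max}) h"
        using assms(11) by (simp add: h_def)
      then have h: "0 \<le> h" "h \<le> \<alpha>max" "h < 1"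
        using \<alpha>max by (auto simp: is_arg_min_def)
      \<comment> \<open>From the true to the empirical error at \<open>h\<close>, by minimality to the empirical error at \<open>\<alpha>\<close>, and
        back to the true error at \<open>\<alpha>\<close>. The penalty at \<open>h\<close> is added before minimality is used.\<close>
      have "trimmed_error P h g = trimmed_rate h r"
        using h by (intro trimmed_error_eq)
      also have "\<dots> \<le> trimmed_rate h (emp_error n (S \<omega>) g) + \<bar>D \<omega>\<bar> / (1 - h)"
        using trimmed_rate_lipschitz[OF h(3), of r "emp_error n (S \<omega>) g"]
        by (simp add: D_def abs_minus_commute)
      also have "\<bar>D \<omega>\<bar> / (1 - h) \<le> \<bar>D \<omega>\<bar> / (1 - \<alpha>max)"
        using h \<alpha>max by (intro divide_left_mono) auto
      also have "trimmed_rate h (emp_error n (S \<omega>) g) \<le> emp_trimmed_error n (S \<omega>) h g + pen n h"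
        using h n pen_nonneg[of h] by (simp add: emp_trimmed_error_eq)
      also have "\<dots> \<le> emp_trimmed_error n (S \<omega>) \<alpha> g + pen n \<alpha>"
        using arg_min \<alpha> by (auto simp: is_arg_min_linorder)
      also have "emp_trimmed_error n (S \<omega>) \<alpha> g = trimmed_rate \<alpha> (emp_error n (S \<omega>) g)"
        using n \<alpha>1 by (intro emp_trimmed_error_eq)
      also have "\<dots> \<le> trimmed_rate \<alpha> r + \<bar>D \<omega>\<bar> / (1 - \<alpha>)"
        using trimmed_rate_lipschitz[OF \<alpha>1(2), of "emp_error n (S \<omega>) g" r] by (simp add: D_def)
      finally show ?thesis
        by (simp add: h_def c_def algebra_simps)
    qed
    have "M.expectation (\<lambda>\<omega>. trimmed_error P (\<alpha>hat (S \<omega>)) g)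
        \<le> M.expectation (\<lambda>\<omega>. trimmed_rate \<alpha> r + pen n \<alpha> + c * \<bar>D \<omega>\<bar>)"
      using D(1) pointwise trimmed_rate_nonneg[of \<alpha> r] pen_nonneg[of \<alpha>] \<alpha>1 \<alpha>max
      by (intro integral_mono') (auto simp: c_def)
    also have "\<dots> = trimmed_rate \<alpha> r + pen n \<alpha> + c * M.expectation (\<lambda>\<omega>. \<bar>D \<omega>\<bar>)"
      using D(1) by (simp add: M.prob_space)
    also have "c * M.expectation (\<lambda>\<omega>. \<bar>D \<omega>\<bar>)
        \<le> sqrt r / (sqrt (real n) * (1 - \<alpha>)) + 1 / (1 - \<alpha>max) * sqrt (2 * pi / real n)"
    proof -
      have "r * (1 - r) \<le> r * 1"
        using r by (intro mult_left_mono) auto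
      then have "sqrt (r * (1 - r) / real n) \<le> sqrt (r / real n)"
        by (intro real_sqrt_le_mono divide_right_mono) auto
      then have dev: "M.expectation (\<lambda>\<omega>. \<bar>D \<omega>\<bar>) \<le> sqrt (r / real n)"
        using D(2) by (rule order_trans[rotated])
      have "r \<le> 2 * pi"
        using r(2) pi_gt3 by linarith
      then have "sqrt (r / real n) \<le> sqrt (2 * pi / real n)"
        by (intro real_sqrt_le_mono divide_right_mono) auto
      with dev have dev': "M.expectation (\<lambda>\<omega>. \<bar>D \<omega>\<bar>) \<le> sqrt (2 * pi / real n)"
        by (rule order_trans)
      have "c * M.expectation (\<lambda>\<omega>. \<bar>D \<omega>\<bar>) = 1 / (1 - \<alpha>) * M.expectation (\<lambda>\<omega>. \<bar>D \<omega>\<bar>)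
          + 1 / (1 - \<alpha>max) * M.expectation (\<lambda>\<omega>. \<bar>D \<omega>\<bar>)"
        by (simp add: c_def distrib_right)
      also have "\<dots> \<le> 1 / (1 - \<alpha>) * sqrt (r / real n) + 1 / (1 - \<alpha>max) * sqrt (2 * pi / real n)"
        using dev dev' \<alpha>1 \<alpha>max by (intro add_mono mult_left_mono) auto
      finally show ?thesis
        by (simp add: real_sqrt_divide mult.commute)
    qed
    finally show ?thesis
      using trimmed_error_eq[OF \<alpha>1] by simp
  qed
  have "M.expectation (\<lambda>\<omega>. trimmed_error P (\<alpha>hat (S \<omega>)) g) - 1 / (1 - \<alpha>max) * sqrt (2 * pi / real n)
      \<le> (INF \<alpha>\<in>{0..\<alpha>max}. trimmed_error P \<alpha> g + pen n \<alpha> + sqrt r / (sqrt (real n) * (1 - \<alpha>)))"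
    using \<alpha>max risk_bound by (intro cINF_greatest) (auto simp: diff_le_eq)
  moreover have "0 \<le> 1 / (real n * (1 - \<alpha>max)^2)"
    by simp
  ultimately show ?thesis
    unfolding S_def r_def by linarith
qed

end
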